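(* Let $x,y\in(0,1]$. Then $$B(x,y)>\frac{x+y}{xy}\left(1-\frac{2xy}{x+y+1}\right).$$
   Context: $B$ denotes Euler's beta function, defined for real $x,y>0$ by $B(x,y)=\int_0^1 t^{x-1}(1-t)^{y-1}\,dt$; equivalently $B(x,y)=\Gamma(x)\Gamma(y)/\Gamma(x+y)$, where $\Gamma(x)=\int_0^\infty e^{-t}t^{x-1}\,dt$ for $x>0$ is the classical gamma function. *)

theory Defs
  imports "HOL-Analysis.Analysis"
begin

(* The library defines Beta through Gamma; this lemma identifies it with Euler's integral. *)
lemma Beta_real_eq_integral:
  fixes x y :: real
  assumes "0 < x" and "0 < y"
  shows "Beta x y = integral {0..1} (\<lambda>t. t powr (x - 1) * (1 - t) powr (y - 1))"
  using has_integral_Beta_real[OF assms] by (simp add: integral_unique)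

end

theory Submission
  imports Defs
begin

text \<open>
  Euler's limit formula for the Gamma function writes \<open>Beta x y\<close> as \<open>(x + y) / (x y)\<close> times the
  infinite product of \<open>1 - x y / ((k + x) (k + y))\<close> over \<open>k \<ge> 1\<close>. By Weierstrass' inequality such a
  product is at least \<open>1\<close> minus the sum of the subtracted terms, so it remains to see that the
  sum of \<open>1 / ((k + x) (k + y))\<close> over \<open>k \<ge> 1\<close> is less than \<open>2 / (x + y + 1)\<close>.

  Put \<open>c = (x + y) / 2\<close>. Then \<open>(k + x) (k + y) = (k + c)\<^sup>2 - (x - y)\<^sup>2 / 4\<close>, and since
  \<open>\<bar>x - y\<bar> < 1\<close> this exceeds \<open>(k + c)\<^sup>2 - 1/4 = (k + c - 1/2) (k + c + 1/2)\<close>. Hence each term is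
  less than \<open>1 / (k + c - 1/2) - 1 / (k + c + 1/2)\<close>, and these differences telescope to
  \<open>1 / (c + 1/2) = 2 / (x + y + 1)\<close>.
\<close>

lemma pochhammer_quotient_eq_prod:
  fixes x y :: real
  assumes "0 < x" "0 < y"
  shows "fact n * pochhammer (x + y) (Suc n) / (pochhammer x (Suc n) * pochhammer y (Suc n))
         = (x + y) / (x * y) * (\<Prod>k=1..n. 1 - x * y / ((real k + x) * (real k + y)))"
proof (induction n)
  case 0
  then show ?case by simp
next
  case (Suc n)
  let ?m = "real (Suc n)"
  have pos: "?m + x > 0" "?m + y > 0" using assms by simp_all
  have factor: "1 - x * y / ((?m + x) * (?m + y)) = ?m * (?m + x + y) / ((?m + x) * (?m + y))"
    using pos by (simp add: divide_simps del: of_nat_Suc) (simp add: algebra_simps)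
  have "fact (Suc n) * pochhammer (x + y) (Suc (Suc n))
          / (pochhammer x (Suc (Suc n)) * pochhammer y (Suc (Suc n)))
        = fact n * pochhammer (x + y) (Suc n) / (pochhammer x (Suc n) * pochhammer y (Suc n))
          * (?m * (?m + x + y) / ((?m + x) * (?m + y)))"
    unfolding pochhammer_Suc[of _ "Suc n"] fact_Suc by (simp add: ac_simps del: of_nat_Suc)
  then show ?case
    unfolding Suc.IH factor[symmetric] by (simp add: mult.assoc)
qed

lemma Beta_real_product_LIMSEQ:
  fixes x y :: real
  assumes "0 < x" "0 < y"
  shows "(\<lambda>n. (x + y) / (x * y) * (\<Prod>k=1..n. 1 - x * y / ((real k + x) * (real k + y))))
           \<longlonglongrightarrow> Beta x y"
proof -
  have "Gamma (x + y) \<noteq> 0"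
    using Gamma_real_pos[of "x + y"] assms by linarith
  then have "(\<lambda>n. Gamma_series x n * Gamma_series y n / Gamma_series (x + y) n) \<longlonglongrightarrow> Beta x y"
    unfolding Beta_def by (intro tendsto_intros Gamma_series_LIMSEQ)
  moreover have "Gamma_series x n * Gamma_series y n / Gamma_series (x + y) n
      = fact n * pochhammer (x + y) (Suc n) / (pochhammer x (Suc n) * pochhammer y (Suc n))" for n
    by (simp add: Gamma_series_def distrib_right exp_add)
  ultimately show ?thesis
    by (simp only: pochhammer_quotient_eq_prod[OF assms])
qed

lemma inverse_shifted_product_less_telescope:
  fixes x y :: real
  assumes "0 < x" "0 < y" "\<bar>x - y\<bar> < 1" "k \<ge> 1"
  shows "1 / ((real k + x) * (real k + y))
         < 1 / (real k + (x + y - 1) / 2) - 1 / (real (Suc k) + (x + y - 1) / 2)"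
proof -
  define u where "u = real k + (x + y - 1) / 2"
  have "real k \<ge> 1" using assms(4) by simp
  then have u: "u > 0" using assms(1,2) by (simp add: u_def field_simps)
  have "(x - y)\<^sup>2 < 1"
    using assms(3) by (simp add: abs_square_less_1)
  moreover have "(real k + x) * (real k + y) - u * (u + 1) = (1 - (x - y)\<^sup>2) / 4"
    unfolding u_def by (simp add: field_simps power2_eq_square)
  ultimately have "0 < (real k + x) * (real k + y) - u * (u + 1)" by simp
  then have "u * (u + 1) < (real k + x) * (real k + y)" by simp
  moreover have "0 < u * (u + 1)" using u by simp
  ultimately have "1 / ((real k + x) * (real k + y)) < 1 / (u * (u + 1))"
    by (intro frac_less2) simp_all
  also have "\<dots> = 1 / u - 1 / (u + 1)"
    using u by (simp add: field_simps)
  finally show ?thesis by (simp add: u_def add_ac)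
qed

theorem theorem1p1:
  fixes x y :: real
  assumes "0 < x" and "x \<le> 1"
    and "0 < y" and "y \<le> 1"
  shows "Beta x y > (x + y) / (x * y) * (1 - 2 * x * y / (x + y + 1))"
proof -
  define a where "a k = 1 / ((real k + x) * (real k + y))" for k
  define d where "d k = 1 / (real k + (x + y - 1) / 2)" for k
  \<comment> \<open>The gap of the first term keeps the inequality strict in the limit.\<close>
  define e where "e = d 1 - d 2 - a 1"
  have "\<bar>x - y\<bar> < 1" using assms by linarith
  then have a_less: "a k < d k - d (Suc k)" if "k \<ge> 1" for k
    using inverse_shifted_product_less_telescope[of x y k] assms that by (simp only: a_def d_def)
  have e: "e > 0" using a_less[of 1] by (simp add: e_def numeral_2_eq_2)
  have d_nonneg: "d (Suc k) \<ge> 0" for k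
    using assms by (simp add: d_def field_simps)
  have d1: "d 1 = 2 / (x + y + 1)" using assms by (simp add: d_def field_simps)
  have sum_le_telescope: "(\<Sum>k=1..Suc n. a k) \<le> d 1 - e - d (Suc (Suc n))" for n
  proof (induction n)
    case 0
    then show ?case by (simp add: e_def numeral_2_eq_2)
  next
    case (Suc n)
    then show ?case using a_less[of "Suc (Suc n)"] by simp
  qed
  have sum_le: "(\<Sum>k=1..Suc n. a k) \<le> 2 / (x + y + 1) - e" for n
    using sum_le_telescope[of n] d_nonneg[of "Suc n"] d1 by linarith
  have a_bounds: "x * y * a k \<in> {0..1}" for k
  proof -
    have "x * y \<le> (real k + x) * (real k + y)"
      using assms by (intro mult_mono) auto
    moreover have "0 < (real k + x) * (real k + y)" using assms by (simp add: add_nonneg_pos)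
    ultimately show ?thesis using assms by (simp add: a_def)
  qed
  have prod_ge: "1 - x * y * (2 / (x + y + 1) - e) \<le> (\<Prod>k=1..n. 1 - x * y * a k)" if n: "n \<ge> 1" for n
  proof -
    have "(\<Sum>k=1..n. a k) \<le> 2 / (x + y + 1) - e"
      using sum_le[of "n - 1"] n by simp
    then have "x * y * (\<Sum>k=1..n. a k) \<le> x * y * (2 / (x + y + 1) - e)"
      using assms by (intro mult_left_mono) auto
    moreover have "1 - (\<Sum>k=1..n. x * y * a k) \<le> (\<Prod>k=1..n. 1 - x * y * a k)"
      using a_bounds by (intro Weierstrass_prod_ineq) auto
    ultimately show ?thesis by (simp add: sum_distrib_left)
  qed
  have coeff: "(x + y) / (x * y) > 0" using assms by simp
  have "(\<lambda>n. (x + y) / (x * y) * (\<Prod>k=1..n. 1 - x * y * a k)) \<longlonglongrightarrow> Beta x y"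
    using Beta_real_product_LIMSEQ[of x y] assms by (simp add: a_def)
  then have limit_ge: "(x + y) / (x * y) * (1 - x * y * (2 / (x + y + 1) - e)) \<le> Beta x y"
    by (rule LIMSEQ_le_const)
       (intro exI[of _ 1] allI impI mult_left_mono prod_ge less_imp_le[OF coeff])
  have "x * y * e > 0" using assms e by simp
  then have "1 - 2 * x * y / (x + y + 1) < 1 - x * y * (2 / (x + y + 1) - e)"
    by (simp add: algebra_simps)
  with coeff have "(x + y) / (x * y) * (1 - 2 * x * y / (x + y + 1))
      < (x + y) / (x * y) * (1 - x * y * (2 / (x + y + 1) - e))"
    by (rule mult_strict_left_mono[rotated])
  with limit_ge show ?thesis by linarith
qed

end
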